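(* Let $K$ be a finite simplicial complex with a chosen total ordering of its vertices, let $n$ be a positive integer, and let $W(K,n)$ be the discrete gradient field on $\operatorname{DConf}(K,n)$ constructed by the algorithm described in the context. Then $W(K,n)$ is maximal in the following sense: if $\alpha$ is a critical $p$-dimensional cell of $\operatorname{DConf}(K,n)$, then no $(p-1)$-dimensional face of $\alpha$ and no $(p+1)$-dimensional coface of $\alpha$ is critical.
   Context: Discrete Morse theory. For a finite regular CW complex $X$, the directed Hasse diagram $H$ has the cells of $X$ as vertices and a directed edge $\alpha^{(p+1)}\searrow\beta^{(p)}$ whenever $\beta$ is a codimension-one face of $\alpha$ (superscripts denote dimension). A discrete field is a subgraph $W$ of $H$ all of whose vertices have degree 1 in $W$ (i.e. a matching). Reversing in $H$ the arrows of $W$ gives $H_W$; reversed arrows are written $\beta^{(p)}\nearrow\alpha^{(p+1)}$, and then $\alpha$ is called collapsible and $\beta$ redundant. Cells not involved in $W$ are critical. A gradient path is a chain $\alpha_0\nearrow\beta_1\searrow\alpha_1\nearrow\cdots\nearrow\beta_k\searrow\alpha_k$ in $H_W$ with $k>0$; it is a cycle if $\alpha_0=\alpha_k$. The field is gradient if it has no cycles. The complex. Let $K$ be a finite simplicial complex with vertex set $V=\{1,2,\ldots,m\}$ (the identification encoding the chosen order). $\operatorname{DConf}(K,n)$ is the subcomplex of the product complex $K^n$ whose cells are the products $\alpha=(\alpha_1,\ldots,\alpha_n)$ of simplices of $K$ with pairwise disjoint vertex sets. Let $V(\alpha)$ be the union of these vertex sets. For $v\in V\setminus V(\alpha)$ such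 that adding $v$ to $\alpha_i$ gives a simplex of $K$, $\alpha+_iv$ denotes the cell obtained by adding $v$ to the $i$-th entry. Order on cells. Simplices of $K$ of the same dimension, written as increasing lists of vertices, are ordered lexicographically; simplices of smaller dimension precede those of larger dimension. Cells of $K^n$ are then ordered lexicographically over the $n$ coordinates. Construction of $W(K,n)$. Initialize $W:=\varnothing$ and, for each $p$, let $A^p$ be the set of all $p$-dimensional cells of $X=\operatorname{DConf}(K,n)$ ("available" cells). For $p=\dim X-1,\dim X-2,\ldots,0$ (in that order), provided $A^p$ and $A^{p+1}$ are currently nonempty, do: for $r=n,n-1,\ldots,1$ (in that order); for $u=m,m-1,\ldots,1$ (in that order); for $\alpha$ running through the current $A^p$ in increasing order: if $\alpha+_ru$ is defined and currently $(\alpha,\alpha+_ru)\in A^p\times A^{p+1}$, add the directed edge $\alpha\nearrow\alpha+_ru$ to $W$, and remove $\alpha$ from $A^p$ and $\alpha+_ru$ from $A^{p+1}$. The final $W$ is $W(K,n)$. *)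

theory Defs
  imports Main "HOL-Library.List_Lenlexorder"
begin

definition simplicial_complex_on :: "'v set \<Rightarrow> 'v set set \<Rightarrow> bool" where
  "simplicial_complex_on V K \<longleftrightarrow> finite V \<and>
     (\<forall>\<sigma>\<in>K. \<sigma> \<noteq> {} \<and> \<sigma> \<subseteq> V) \<and>
     (\<forall>v\<in>V. {v} \<in> K) \<and>
     (\<forall>\<sigma>\<in>K. \<forall>\<tau>. \<tau> \<noteq> {} \<and> \<tau> \<subseteq> \<sigma> \<longrightarrow> \<tau> \<in> K)"

text \<open>A cell of \<open>K\<^sup>n\<close> is the list of its \<open>n\<close> factors. Coordinates are therefore
  numbered from \<open>0\<close> to \<open>n - 1\<close>.\<close>

type_synonym cell = "nat set list"

definition cell_vertices :: "cell \<Rightarrow> nat set" where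
  "cell_vertices \<alpha> = \<Union> (set \<alpha>)"

definition cell_dim :: "cell \<Rightarrow> nat" where
  "cell_dim \<alpha> = (\<Sum>\<sigma>\<leftarrow>\<alpha>. card \<sigma> - 1)"

definition DConf :: "nat set set \<Rightarrow> nat \<Rightarrow> cell set" where
  "DConf K n = {\<alpha>. length \<alpha> = n \<and> set \<alpha> \<subseteq> K \<and>
     (\<forall>i<n. \<forall>j<n. i \<noteq> j \<longrightarrow> \<alpha> ! i \<inter> \<alpha> ! j = {})}"

definition face :: "cell \<Rightarrow> cell \<Rightarrow> bool" where
  "face \<beta> \<alpha> \<longleftrightarrow> list_all2 (\<subseteq>) \<beta> \<alpha>"

text \<open>The dimension of the empty complex is set to \<open>0\<close>, so that the main loop below
  is empty in that case.\<close>

definition complex_dim :: "cell set \<Rightarrow> nat" where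
  "complex_dim X = (if X = {} then 0 else Max (cell_dim ` X))"

text \<open>With the order of \<^theory>\<open>HOL-Library.List_Lenlexorder\<close>, lists are compared first by
  length and then lexicographically. On the increasing vertex lists of simplices this is the
  order by dimension and then lexicographically; on lists of \<open>n\<close> such lists it is the
  lexicographic order over the coordinates.\<close>

definition cell_key :: "cell \<Rightarrow> nat list list" where
  "cell_key \<alpha> = map sorted_list_of_set \<alpha>"

definition increasing_list :: "cell set \<Rightarrow> cell list" where
  "increasing_list A = sorted_key_list_of_set cell_key A"

definition add_vertex :: "cell \<Rightarrow> nat \<Rightarrow> nat \<Rightarrow> cell" where
  "add_vertex \<alpha> r u = \<alpha>[r := insert u (\<alpha> ! r)]"

definition add_defined :: "nat set set \<Rightarrow> cell \<Rightarrow> nat \<Rightarrow> nat \<Rightarrow> bool" where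
  "add_defined K \<alpha> r u \<longleftrightarrow> u \<notin> cell_vertices \<alpha> \<and> insert u (\<alpha> ! r) \<in> K"

text \<open>A state is a pair \<open>(W, A)\<close> of the set of edges \<open>\<alpha> \<nearrow> \<beta>\<close> chosen so far and the
  sets \<open>A p\<close> of available \<open>p\<close>-cells.\<close>

type_synonym state = "(cell \<times> cell) set \<times> (nat \<Rightarrow> cell set)"

definition try_cell :: "nat set set \<Rightarrow> nat \<Rightarrow> nat \<Rightarrow> nat \<Rightarrow> cell \<Rightarrow> state \<Rightarrow> state" where
  "try_cell K p r u \<alpha> s = (case s of (W, A) \<Rightarrow>
     let \<beta> = add_vertex \<alpha> r u in
     if add_defined K \<alpha> r u \<and> \<alpha> \<in> A p \<and> \<beta> \<in> A (p + 1)
     then (insert (\<alpha>, \<beta>) W, A(p := A p - {\<alpha>}, p + 1 := A (p + 1) - {\<beta>}))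
     else (W, A))"

definition vertex_step :: "nat set set \<Rightarrow> nat \<Rightarrow> nat \<Rightarrow> nat \<Rightarrow> state \<Rightarrow> state" where
  "vertex_step K p r u s = fold (try_cell K p r u) (increasing_list (snd s p)) s"

definition coordinate_step :: "nat \<Rightarrow> nat set set \<Rightarrow> nat \<Rightarrow> nat \<Rightarrow> state \<Rightarrow> state" where
  "coordinate_step m K p r s = fold (vertex_step K p r) (rev [1..<m + 1]) s"

definition dimension_step :: "nat \<Rightarrow> nat set set \<Rightarrow> nat \<Rightarrow> nat \<Rightarrow> state \<Rightarrow> state" where
  "dimension_step m K n p s =
     (if snd s p \<noteq> {} \<and> snd s (p + 1) \<noteq> {}
      then fold (coordinate_step m K p) (rev [0..<n]) s else s)"

definition initial_state :: "nat set set \<Rightarrow> nat \<Rightarrow> state" where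
  "initial_state K n = ({}, \<lambda>p. {\<alpha> \<in> DConf K n. cell_dim \<alpha> = p})"

definition W_field :: "nat \<Rightarrow> nat set set \<Rightarrow> nat \<Rightarrow> (cell \<times> cell) set" where
  "W_field m K n =
     fst (fold (dimension_step m K n) (rev [0..<complex_dim (DConf K n)]) (initial_state K n))"

definition critical :: "cell set \<Rightarrow> (cell \<times> cell) set \<Rightarrow> cell \<Rightarrow> bool" where
  "critical X W \<alpha> \<longleftrightarrow> \<alpha> \<in> X \<and> \<alpha> \<notin> Field W"

end

theory Submission
  imports Defs
begin

text \<open>A cell leaves the available sets only when an edge at it enters \<open>W\<close>, so a critical cell
  is available throughout. If \<open>\<beta>\<close> is a codimension-one face of \<open>\<alpha>\<close> in \<open>DConf K n\<close>, then
  \<open>\<alpha> = \<beta> +\<^sub>r u\<close> for some \<open>r\<close> and \<open>u\<close>, and the triple \<open>(r, u, \<beta>)\<close> is examined in the step of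
  dimension \<open>dim \<beta>\<close>. If both cells were still available then, they would be matched with each
  other; hence they are not both critical.\<close>

section \<open>Faces and dimension of product cells\<close>

lemma cell_dim_simps [simp]:
  "cell_dim [] = 0"
  "cell_dim (\<sigma> # \<alpha>) = card \<sigma> - 1 + cell_dim \<alpha>"
  by (simp_all add: cell_dim_def)

lemma face_cell_dim_le:
  assumes "face \<beta> \<alpha>" "\<And>\<sigma>. \<sigma> \<in> set \<alpha> \<Longrightarrow> finite \<sigma>"
  shows "cell_dim \<beta> \<le> cell_dim \<alpha>"
  using assms unfolding face_def
proof (induction rule: list_all2_induct)
  case (Cons \<tau> \<beta> \<sigma> \<alpha>)
  moreover from this have "card \<tau> \<le> card \<sigma>"
    by (simp add: card_mono)
  ultimately show ?case
    by fastforce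
qed simp

text \<open>Each summand \<open>card \<sigma> - 1\<close> is monotone under inclusion, so equal
  totals force equal summands. Nonempty factors matter here: truncated subtraction gives
  cardinalities 0 and 1 the same value.\<close>

lemma face_eq_if_cell_dim_eq:
  assumes "face \<beta> \<alpha>" "cell_dim \<alpha> = cell_dim \<beta>"
    and "\<And>\<sigma>. \<sigma> \<in> set \<alpha> \<Longrightarrow> finite \<sigma>" "{} \<notin> set \<beta>"
  shows "\<beta> = \<alpha>"
  using assms unfolding face_def
proof (induction rule: list_all2_induct)
  case (Cons \<tau> \<beta> \<sigma> \<alpha>)
  have fin: "finite \<sigma>" "finite \<tau>" and ne: "\<tau> \<noteq> {}"
    using Cons.prems Cons.hyps finite_subset by auto
  have "card \<tau> \<le> card \<sigma>" "card \<tau> > 0" "cell_dim \<beta> \<le> cell_dim \<alpha>"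
    using Cons.hyps Cons.prems fin ne
    by (auto simp: card_mono card_gt_0_iff face_def intro!: face_cell_dim_le)
  hence "card \<tau> = card \<sigma>" "cell_dim \<alpha> = cell_dim \<beta>"
    using Cons.prems(1) by auto
  thus ?case
    using Cons fin card_subset_eq by auto
qed simp

text \<open>Induction over the coordinates: either the first factors agree and the gap of one lies
  in the tail, or the first factor absorbs the whole gap and the tails coincide.\<close>

lemma codim_one_face_is_add_vertex:
  assumes "face \<beta> \<alpha>" "cell_dim \<alpha> = cell_dim \<beta> + 1"
    and "\<And>\<sigma>. \<sigma> \<in> set \<alpha> \<Longrightarrow> finite \<sigma>" "{} \<notin> set \<beta>"
  shows "\<exists>r<length \<beta>. \<exists>u. u \<notin> \<beta> ! r \<and> \<alpha> = add_vertex \<beta> r u"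
  using assms unfolding face_def
proof (induction rule: list_all2_induct)
  case (Cons \<tau> \<beta> \<sigma> \<alpha>)
  have fin: "finite \<sigma>" "finite \<tau>" and ne: "\<tau> \<noteq> {}"
    using Cons.prems Cons.hyps finite_subset by auto
  have le: "card \<tau> \<le> card \<sigma>" "card \<tau> > 0" "cell_dim \<beta> \<le> cell_dim \<alpha>"
    using Cons.hyps Cons.prems fin ne
    by (auto simp: card_mono card_gt_0_iff face_def intro!: face_cell_dim_le)
  show ?case
  proof (cases "card \<tau> = card \<sigma>")
    case True
    hence eq: "\<tau> = \<sigma>"
      using Cons.hyps fin card_subset_eq by blast
    then obtain r u where "r < length \<beta>" "u \<notin> \<beta> ! r" "\<alpha> = add_vertex \<beta> r u"
      using Cons.IH Cons.prems by auto
    thus ?thesis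
      using eq by (intro exI[of _ "Suc r"]) (auto simp: add_vertex_def)
  next
    case False
    hence card: "card \<sigma> = Suc (card \<tau>)" and dim: "cell_dim \<alpha> = cell_dim \<beta>"
      using le Cons.prems(1) by auto
    have "card (\<sigma> - \<tau>) = 1"
      using Cons.hyps fin card by (simp add: card_Diff_subset)
    then obtain u where "\<sigma> - \<tau> = {u}"
      using card_1_singletonE by blast
    hence "u \<notin> \<tau>" "\<sigma> = insert u \<tau>"
      using Cons.hyps by auto
    moreover have "\<beta> = \<alpha>"
      using Cons.hyps Cons.prems dim by (intro face_eq_if_cell_dim_eq) (auto simp: face_def)
    ultimately show ?thesis
      by (intro exI[of _ 0]) (auto simp: add_vertex_def)
  qed
qed simp

section \<open>Enumeration of finite sets of cells\<close>

lemma finite_DConf: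
  assumes "finite K"
  shows "finite (DConf K n)"
  by (rule finite_subset[OF _ finite_lists_length_eq[OF assms, of n]]) (auto simp: DConf_def)

text \<open>Interpreting the locale with carrier \<open>A\<close> itself reduces its injectivity
  requirement to \<open>A\<close>.\<close>

lemma (in linorder) set_sorted_key_list_of_set_if_inj_on:
  assumes "finite A" "inj_on f A"
  shows "set (sorted_key_list_of_set f A) = A"
proof -
  interpret folding_insort_key "(\<le>)" "(<)" A f
    by unfold_locales (rule assms(2))
  show ?thesis
    using assms(1) by simp
qed

lemma set_increasing_list:
  assumes "finite A" "\<And>\<alpha> \<sigma>. \<alpha> \<in> A \<Longrightarrow> \<sigma> \<in> set \<alpha> \<Longrightarrow> finite \<sigma>"
  shows "set (increasing_list A) = A"
proof -
  have "inj_on cell_key A"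
  proof (rule inj_onI)
    fix \<alpha> \<beta> assume "\<alpha> \<in> A" "\<beta> \<in> A" "cell_key \<alpha> = cell_key \<beta>"
    \<comment> \<open>A left inverse of \<open>cell_key\<close>; it works because \<open>set\<close>
      undoes \<open>sorted_list_of_set\<close> on finite factors.\<close>
    moreover have "map set (cell_key \<gamma>) = \<gamma>" if "\<gamma> \<in> A" for \<gamma>
      using assms(2)[OF that] by (auto simp: cell_key_def map_idI)
    ultimately show "\<alpha> = \<beta>"
      by metis
  qed
  then show ?thesis
    unfolding increasing_list_def by (rule set_sorted_key_list_of_set_if_inj_on[OF assms(1)])
qed

section \<open>Invariants of the nested loops\<close>

definition tracked :: "cell set \<Rightarrow> state \<Rightarrow> bool" where
  "tracked X s \<longleftrightarrow> (\<forall>p. snd s p \<subseteq> X) \<and>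
     (\<forall>\<alpha>\<in>X. \<alpha> \<in> Field (fst s) \<or> \<alpha> \<in> snd s (cell_dim \<alpha>))"

text \<open>Closed under composition, hence it passes through every level of folds.\<close>

definition extends :: "cell set \<Rightarrow> (state \<Rightarrow> state) \<Rightarrow> bool" where
  "extends X f \<longleftrightarrow> (\<forall>s. tracked X s \<longrightarrow> tracked X (f s) \<and> fst s \<subseteq> fst (f s))"

text \<open>Quantifying over all tracked states makes the choices of earlier steps
  irrelevant.\<close>

definition settles :: "cell set \<Rightarrow> cell \<Rightarrow> cell \<Rightarrow> (state \<Rightarrow> state) \<Rightarrow> bool" where
  "settles X \<alpha> \<beta> f \<longleftrightarrow>
     (\<forall>s. tracked X s \<longrightarrow> \<alpha> \<in> Field (fst (f s)) \<or> \<beta> \<in> Field (fst (f s)))"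

lemma extends_fold:
  assumes "\<And>x. x \<in> set xs \<Longrightarrow> extends X (f x)"
  shows "extends X (fold f xs)"
  using assms
proof (induction xs)
  case (Cons x xs)
  then have "extends X (f x)" "extends X (fold f xs)"
    by auto
  then show ?case
    unfolding extends_def fold_simps by (blast dest: subset_trans)
qed (simp add: extends_def)

text \<open>The steps before \<open>x\<close> keep the state tracked, and those after
  \<open>x\<close> only enlarge the set of edges.\<close>

lemma settles_fold:
  assumes "\<And>x. x \<in> set xs \<Longrightarrow> extends X (f x)" "x \<in> set xs" "settles X \<alpha> \<beta> (f x)"
  shows "settles X \<alpha> \<beta> (fold f xs)"
proof -
  obtain ys zs where xs: "xs = ys @ x # zs"
    using assms(2) split_list by metis
  have ext: "extends X (fold f ys)" "extends X (f x)" "extends X (fold f zs)"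
    using assms(1) xs by (auto intro: extends_fold)
  show ?thesis
    unfolding settles_def
  proof (intro allI impI)
    fix s assume "tracked X s"
    with ext(1) have tr: "tracked X (fold f ys s)"
      unfolding extends_def by blast
    let ?t = "f x (fold f ys s)"
    have "\<alpha> \<in> Field (fst ?t) \<or> \<beta> \<in> Field (fst ?t)"
      using assms(3) tr unfolding settles_def by blast
    moreover have "fst ?t \<subseteq> fst (fold f zs ?t)"
      using ext(2,3) tr unfolding extends_def by blast
    ultimately show "\<alpha> \<in> Field (fst (fold f xs s)) \<or> \<beta> \<in> Field (fst (fold f xs s))"
      using mono_Field by (auto simp: xs)
  qed
qed

text \<open>The two cells removed are exactly the endpoints of the edge inserted.\<close>

lemma extends_try_cell: "extends X (try_cell K p r u \<alpha>)"
  by (auto simp: extends_def tracked_def try_cell_def Let_def Field_insert split: prod.splits)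

lemma extends_vertex_step: "extends X (vertex_step K p r u)"
proof -
  have "extends X (fold (try_cell K p r u) xs)" for xs
    by (intro extends_fold extends_try_cell)
  then show ?thesis
    unfolding extends_def vertex_step_def by blast
qed

lemma extends_coordinate_step: "extends X (coordinate_step m K p r)"
proof -
  have "extends X (fold (vertex_step K p r) xs)" for xs
    by (intro extends_fold extends_vertex_step)
  then show ?thesis
    unfolding extends_def coordinate_step_def by blast
qed

lemma extends_dimension_step: "extends X (dimension_step m K n p)"
proof -
  have "extends X (fold (coordinate_step m K p) xs)" for xs
    by (intro extends_fold extends_coordinate_step)
  then show ?thesis
    unfolding extends_def dimension_step_def by (simp del: split_paired_All)
qed

text \<open>If neither cell is matched beforehand, the invariant makes both available in their
  dimensions, so the test succeeds and the edge is added.\<close>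

lemma settles_try_cell:
  assumes "\<alpha> \<in> X" "add_vertex \<alpha> r u \<in> X" "add_defined K \<alpha> r u"
    and "cell_dim (add_vertex \<alpha> r u) = cell_dim \<alpha> + 1"
  shows "settles X \<alpha> (add_vertex \<alpha> r u) (try_cell K (cell_dim \<alpha>) r u \<alpha>)"
  using assms
  by (fastforce simp: settles_def tracked_def try_cell_def Let_def Field_insert split: prod.splits)

lemma settles_vertex_step:
  assumes "finite X" "\<And>\<alpha> \<sigma>. \<alpha> \<in> X \<Longrightarrow> \<sigma> \<in> set \<alpha> \<Longrightarrow> finite \<sigma>"
    and "\<alpha> \<in> X" "add_vertex \<alpha> r u \<in> X" "add_defined K \<alpha> r u"
    and "cell_dim (add_vertex \<alpha> r u) = cell_dim \<alpha> + 1"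
  shows "settles X \<alpha> (add_vertex \<alpha> r u) (vertex_step K (cell_dim \<alpha>) r u)"
  unfolding settles_def
proof (intro allI impI)
  fix s assume tr: "tracked X s"
  let ?t = "vertex_step K (cell_dim \<alpha>) r u s"
  let ?xs = "increasing_list (snd s (cell_dim \<alpha>))"
  have set_xs: "set ?xs = snd s (cell_dim \<alpha>)"
  proof (rule set_increasing_list)
    have "snd s (cell_dim \<alpha>) \<subseteq> X"
      using tr by (simp add: tracked_def)
    then show "finite (snd s (cell_dim \<alpha>))"
      and "\<And>\<gamma> \<sigma>. \<gamma> \<in> snd s (cell_dim \<alpha>) \<Longrightarrow> \<sigma> \<in> set \<gamma> \<Longrightarrow> finite \<sigma>"
      using assms(1,2) finite_subset by blast+
  qed
  show "\<alpha> \<in> Field (fst ?t) \<or> add_vertex \<alpha> r u \<in> Field (fst ?t)"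
  \<comment> \<open>The list is read off \<open>s\<close> before the inner fold starts; a cell
    missing from it is already matched.\<close>
  proof (cases "\<alpha> \<in> snd s (cell_dim \<alpha>)")
    case True
    then have "settles X \<alpha> (add_vertex \<alpha> r u) (fold (try_cell K (cell_dim \<alpha>) r u) ?xs)"
      using set_xs assms(3-6)
      by (intro settles_fold[of _ X _ \<alpha>] extends_try_cell settles_try_cell) auto
    then show ?thesis
      using tr by (simp add: settles_def vertex_step_def del: split_paired_All)
  next
    case False
    then have "\<alpha> \<in> Field (fst s)"
      using tr assms(3) by (auto simp: tracked_def)
    moreover have "fst s \<subseteq> fst ?t"
      using tr extends_vertex_step unfolding extends_def by blast
    ultimately show ?thesis
      using mono_Field by blast
  qed
qed

lemma settles_dimension_step:
  assumes "finite X" "\<And>\<alpha> \<sigma>. \<alpha> \<in> X \<Longrightarrow> \<sigma> \<in> set \<alpha> \<Longrightarrow> finite \<sigma>"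
    and "\<alpha> \<in> X" "add_vertex \<alpha> r u \<in> X" "add_defined K \<alpha> r u"
    and "cell_dim (add_vertex \<alpha> r u) = cell_dim \<alpha> + 1"
    and "r < n" "1 \<le> u" "u \<le> m"
  shows "settles X \<alpha> (add_vertex \<alpha> r u) (dimension_step m K n (cell_dim \<alpha>))"
proof -
  have "settles X \<alpha> (add_vertex \<alpha> r u) (fold (vertex_step K (cell_dim \<alpha>) r) (rev [1..<m + 1]))"
    using settles_vertex_step[OF assms(1-6)] assms(8,9)
    by (intro settles_fold[of _ X _ u] extends_vertex_step) auto
  then have "settles X \<alpha> (add_vertex \<alpha> r u) (coordinate_step m K (cell_dim \<alpha>) r)"
    by (simp add: settles_def coordinate_step_def)
  then have "settles X \<alpha> (add_vertex \<alpha> r u)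
      (fold (coordinate_step m K (cell_dim \<alpha>)) (rev [0..<n]))"
    using assms(7) by (intro settles_fold[of _ X _ r] extends_coordinate_step) auto
  \<comment> \<open>If the guard of \<open>dimension_step\<close> fails, one of the two levels is
    empty, and by the invariant the cell of that dimension is already matched.\<close>
  then show ?thesis
    using assms(3,4,6) by (auto simp: settles_def dimension_step_def tracked_def)
qed

section \<open>Application to the configuration complex\<close>

lemma codim_one_face_not_both_critical:
  assumes K: "simplicial_complex_on {1..m} K"
    and in_X: "\<beta> \<in> DConf K n" "\<alpha> \<in> DConf K n"
    and face: "face \<beta> \<alpha>" and dim: "cell_dim \<alpha> = cell_dim \<beta> + 1"
  shows "\<beta> \<in> Field (W_field m K n) \<or> \<alpha> \<in> Field (W_field m K n)"
proof -
  let ?X = "DConf K n"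
  have K_simplex: "\<sigma> \<noteq> {}" "\<sigma> \<subseteq> {1..m}" if "\<sigma> \<in> K" for \<sigma>
    using K that by (auto simp: simplicial_complex_on_def)
  then have "finite K"
    by (intro finite_subset[of K "Pow {1..m}"]) auto
  then have fin_X: "finite ?X"
    by (rule finite_DConf)
  have fin_cell: "finite \<sigma>" if "\<gamma> \<in> ?X" "\<sigma> \<in> set \<gamma>" for \<gamma> \<sigma>
    using that K_simplex(2) finite_subset[of \<sigma> "{1..m}"] by (auto simp: DConf_def)
  have "{} \<notin> set \<beta>"
    using in_X(1) K_simplex(1) by (auto simp: DConf_def)
  then obtain r u where r: "r < length \<beta>" and u: "u \<notin> \<beta> ! r" and \<alpha>: "\<alpha> = add_vertex \<beta> r u"
    using codim_one_face_is_add_vertex[OF face dim fin_cell[OF in_X(2)]] by blast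
  have len: "length \<beta> = n" "length \<alpha> = n"
    using in_X by (auto simp: DConf_def)
  have \<alpha>r: "\<alpha> ! r = insert u (\<beta> ! r)"
    using r by (simp add: \<alpha> add_vertex_def)
  have "\<alpha> ! r \<in> K"
    using in_X(2) r len by (auto simp: DConf_def)
  \<comment> \<open>Disjointness of the factors of \<alpha> keeps the new vertex out of all other
    coordinates.\<close>
  moreover have "u \<notin> \<beta> ! j" if "j < n" for j
  proof (cases "j = r")
    case False
    then have "\<alpha> ! j = \<beta> ! j"
      by (simp add: \<alpha> add_vertex_def)
    moreover have "\<alpha> ! j \<inter> \<alpha> ! r = {}"
      using in_X(2) that r len False by (simp add: DConf_def)
    ultimately show ?thesis
      using \<alpha>r by auto
  qed (use u in simp)
  ultimately have "add_defined K \<beta> r u" and "u \<in> {1..m}"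
    using K_simplex(2)[of "\<alpha> ! r"] len
    by (auto simp: add_defined_def \<alpha>r cell_vertices_def in_set_conv_nth)
  then have "settles ?X \<beta> \<alpha> (dimension_step m K n (cell_dim \<beta>))"
    unfolding \<alpha> using in_X dim r len fin_X fin_cell
    by (intro settles_dimension_step) (auto simp: \<alpha>)
  \<comment> \<open>Strictness comes from \<alpha>, one dimension higher; it puts
    \<open>cell_dim \<beta>\<close> in the range of the main loop.\<close>
  moreover have "cell_dim \<beta> < complex_dim ?X"
    using Max_ge[OF finite_imageI[OF fin_X] imageI[OF in_X(2)], of cell_dim] in_X(2) dim
    by (auto simp: complex_dim_def)
  ultimately have "settles ?X \<beta> \<alpha> (fold (dimension_step m K n) (rev [0..<complex_dim ?X]))"
    by (intro settles_fold[of _ ?X _ "cell_dim \<beta>"] extends_dimension_step) auto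
  moreover have "tracked ?X (initial_state K n)"
    by (auto simp: tracked_def initial_state_def)
  ultimately show ?thesis
    unfolding settles_def W_field_def by blast
qed

theorem theorem1p5:
  fixes K :: "nat set set" and m n p :: nat and \<alpha> :: cell
  assumes "simplicial_complex_on {1..m} K"
    and "n \<ge> 1"
    and "critical (DConf K n) (W_field m K n) \<alpha>"
    and "cell_dim \<alpha> = p"
  shows "(\<forall>\<beta>\<in>DConf K n. face \<beta> \<alpha> \<and> cell_dim \<beta> + 1 = p \<longrightarrow>
            \<not> critical (DConf K n) (W_field m K n) \<beta>) \<and>
         (\<forall>\<beta>\<in>DConf K n. face \<alpha> \<beta> \<and> cell_dim \<beta> = p + 1 \<longrightarrow>
            \<not> critical (DConf K n) (W_field m K n) \<beta>)"
  \<comment> \<open>The lemma is used twice, with the given critical cell as the larger and as the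
    smaller of the two.\<close>
  using assms codim_one_face_not_both_critical[OF assms(1)] unfolding critical_def by metis

end
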